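(* Let $d\ge 1$, $\Omega=(-\pi,\pi)^d$ with periodic boundary conditions, and let $\lambda\in[0,1]$. Consider the stabilized Lawson2 scheme with parameter $\alpha=0.327$ and time step size $\tau>0$ $$\begin{aligned} U &= u^n+\alpha\tau\,\mathrm{e}^{\alpha\tau\lambda\Delta}\Delta u^n,\\ u^{n+1} &= u^n+\tau\,\mathrm{e}^{\frac{\tau}{2}\lambda\Delta}\Delta u^n+\frac{\tau}{2\alpha}\mathrm{e}^{\tau\lambda\Delta}(1-\lambda)\Delta(U-u^n) \end{aligned}$$ for the heat equation $\partial_t u=\lambda\Delta u+(1-\lambda)\Delta u$ on $\Omega$. If $\lambda\ge 0.183$, then this scheme is unconditionally stable.
   Context: Functions of $\Delta$ act on periodic functions as Fourier multipliers, $\Delta$ acting on the $\boldsymbol k$-th Fourier mode ($\boldsymbol k\in\mathbb{Z}^d$) as multiplication by $-k^2$, where $k^2=\sum_{\mu=1}^d k_\mu^2$. The scheme therefore acts on each Fourier coefficient $\hat u^n_{\boldsymbol k}$ of $u^n$ by $\hat u^{n+1}_{\boldsymbol k}=\Phi(z,\lambda)\,\hat u^n_{\boldsymbol k}$ with $z=-\tau k^2$, where the stability function $\Phi(z,\lambda)$ is the scalar amplification factor obtained by formally replacing every occurrence of $\tau\Delta$ in the scheme by the real number $z$ and eliminating $U$. The scheme (with parameters $\lambda$, $\alpha$) is called unconditionally stable if $|\Phi(z,\lambda)|\le 1$ for all $z\in(-\infty,0]$. *)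

theory Defs
  imports "HOL-Analysis.Analysis"
begin

definition Omega :: "(real ^ 'd) set" where
  "Omega = box (\<chi> i. - pi) (\<chi> i. pi)"

text \<open>Complex-valued functions on \<open>Omega\<close> with periodic boundary conditions, regarded as
  \<open>2 * pi\<close>-periodic functions on the whole space. Only integrability over a period is required, which
  is what makes the Fourier coefficients meaningful.\<close>

definition periodic_fun :: "(real ^ 'd \<Rightarrow> complex) \<Rightarrow> bool" where
  "periodic_fun u \<longleftrightarrow>
     (\<forall>x i. u (x + axis i (2 * pi)) = u x) \<and> set_integrable lborel Omega u"

definition fourier_coeff :: "(real ^ 'd \<Rightarrow> complex) \<Rightarrow> int ^ 'd \<Rightarrow> complex" where
  "fourier_coeff u k =
     (LINT x:Omega|lborel. u x * exp (- \<i> * of_real (\<Sum>i\<in>UNIV. of_int (k $ i) * x $ i)))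
       / of_real ((2 * pi) ^ CARD('d))"

definition ksq :: "int ^ 'd \<Rightarrow> real" where
  "ksq k = (\<Sum>i\<in>UNIV. (of_int (k $ i))\<^sup>2)"

text \<open>\<open>laplace_fun f u v\<close> says that \<open>v\<close> equals \<open>f(\<Delta>) u\<close>. It is a relation because \<open>v\<close> is
  determined by its Fourier coefficients only up to a null set.\<close>

definition laplace_fun ::
  "(real \<Rightarrow> real) \<Rightarrow> (real ^ 'd \<Rightarrow> complex) \<Rightarrow> (real ^ 'd \<Rightarrow> complex) \<Rightarrow> bool" where
  "laplace_fun f u v \<longleftrightarrow> periodic_fun u \<and> periodic_fun v \<and>
     (\<forall>k. fourier_coeff v k = of_real (f (- ksq k)) * fourier_coeff u k)"

text \<open>One step \<open>u \<mapsto> u'\<close> with internal stage \<open>U\<close>; below, \<open>V\<close>, \<open>W\<close>, \<open>Y\<close> are the values of the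
  three operator terms of the scheme, and \<open>s\<close> stands for \<open>\<Delta>\<close>.\<close>

definition lawson2_step ::
  "real \<Rightarrow> real \<Rightarrow> real \<Rightarrow> (real ^ 'd \<Rightarrow> complex) \<Rightarrow> (real ^ 'd \<Rightarrow> complex) \<Rightarrow>
   (real ^ 'd \<Rightarrow> complex) \<Rightarrow> bool" where
  "lawson2_step \<tau> lam \<alpha> u U u' \<longleftrightarrow> (\<exists>V W Y.
     laplace_fun (\<lambda>s. exp (\<alpha> * \<tau> * lam * s) * s) u V \<and>
     U = (\<lambda>x. u x + of_real (\<alpha> * \<tau>) * V x) \<and>
     laplace_fun (\<lambda>s. exp (\<tau> / 2 * lam * s) * s) u W \<and>
     laplace_fun (\<lambda>s. exp (\<tau> * lam * s) * (1 - lam) * s) (\<lambda>x. U x - u x) Y \<and>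
     u' = (\<lambda>x. u x + of_real \<tau> * W x + of_real (\<tau> / (2 * \<alpha>)) * Y x))"

text \<open>The scalar counterpart of \<open>lawson2_step\<close>: \<open>z\<close> replaces \<open>\<tau> \<Delta>\<close>, applied to \<open>u = 1\<close>.\<close>

definition stability_function :: "real \<Rightarrow> real \<Rightarrow> real \<Rightarrow> real" where
  "stability_function \<alpha> z lam =
     (let U = 1 + \<alpha> * exp (\<alpha> * lam * z) * z
      in 1 + exp (1 / 2 * lam * z) * z + 1 / (2 * \<alpha>) * exp (lam * z) * (1 - lam) * z * (U - 1))"

definition unconditionally_stable :: "real \<Rightarrow> real \<Rightarrow> bool" where
  "unconditionally_stable lam \<alpha> \<longleftrightarrow> (\<forall>z\<in>{..0}. \<bar>stability_function \<alpha> z lam\<bar> \<le> 1)"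

end

(* With x = - z the stability function is
     1 - x exp (- lam x / 2) + (1 - lam) / 2 x^2 exp (- (1 + alpha) lam x).
   It is at most 1 because exp s >= e s. For y = lam x, being at least -1 means that
     2 lam^2 - (a + b) lam + b >= 0,  a = y exp (- y / 2),  b = y^2 / 2 exp (- 1.327 y).
   For y <= 3.3 the discriminant (a + b)^2 - 8 b is nonpositive. For y >= 3.3 the quadratic increases
   in lam >= 0.183, so only lam = 0.183 is left; there the minimum over y, attained close to
   y = 4.12, is barely positive, and cubic Taylor polynomials of the exponentials at y = 4.12
   are accurate enough to show it. *)
theory Submission
  imports Defs
begin

section \<open>Rational lower bounds for the exponential\<close>

lemma exp_ge_Taylor_even:
  fixes x :: real
  assumes "even n"
  shows "(\<Sum>m<n. x ^ m / fact m) \<le> exp x"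
proof -
  obtain t where "exp x = (\<Sum>m<n. x ^ m / fact m) + exp t / fact n * x ^ n"
    using Maclaurin_exp_le[of x n] by blast
  \<comment> \<open>The Lagrange remainder carries an even power, so it is nonnegative also for
    negative \<open>x\<close>.\<close>
  moreover have "0 \<le> exp t / fact n * x ^ n"
    using assms by (simp add: zero_le_even_power)
  ultimately show ?thesis by linarith
qed

lemma exp_ge_Taylor_cubic: "1 + x + x\<^sup>2 / 2 + x ^ 3 / 6 \<le> exp x" for x :: real
proof -
  have "(\<Sum>m<4. x ^ m / fact m) \<le> exp x"
    by (rule exp_ge_Taylor_even) simp
  then show ?thesis by (simp add: eval_nat_numeral algebra_simps)
qed

lemma exp_ge_tangent: "exp a * (1 + (x - a)) \<le> exp x" for a x :: real
  using mult_left_mono[OF exp_ge_add_one_self[of "x - a"], of "exp a"]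
  by (simp flip: exp_add)

text \<open>The arguments belong to the points y = 3.3, 4.12 and 5.5 used later: 0.53955 = 0.1635 *
  3.3, 1.65 = 3.3 / 2, 2.7291 = 0.827 * 3.3, 2.75 = 5.5 / 2, 2.06 = 4.12 / 2, 3.40724 = 0.827 *
  4.12. The upper bound 1.72 for \<open>exp 0.53955\<close> is encoded as a lower bound at the
  negated argument.\<close>

lemma exp_numeric_bounds:
  "2.7 \<le> exp (1 :: real)"
  "1 / 1.72 \<le> exp (- 0.53955 :: real)"
  "5.2 \<le> exp (1.65 :: real)"
  "15.3 \<le> exp (2.7291 :: real)"
  "15.6 \<le> exp (2.75 :: real)"
  "7.845 \<le> exp (2.06 :: real)"
  "0.0331 \<le> exp (- 3.40724 :: real)"
  subgoal by (rule order.trans[OF _ exp_ge_Taylor_even[of 6]]) 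
    (simp_all add: lessThan_nat_numeral fact_numeral power_divide)
  subgoal by (rule order.trans[OF _ exp_ge_Taylor_even[of 6]]) 
    (simp_all add: lessThan_nat_numeral fact_numeral power_divide)
  subgoal by (rule order.trans[OF _ exp_ge_Taylor_even[of 10]]) 
    (simp_all add: lessThan_nat_numeral fact_numeral power_divide)
  subgoal by (rule order.trans[OF _ exp_ge_Taylor_even[of 12]]) 
    (simp_all add: lessThan_nat_numeral fact_numeral power_divide)
  subgoal by (rule order.trans[OF _ exp_ge_Taylor_even[of 14]]) 
    (simp_all add: lessThan_nat_numeral fact_numeral power_divide)
  subgoal by (rule order.trans[OF _ exp_ge_Taylor_even[of 14]]) 
    (simp_all add: lessThan_nat_numeral fact_numeral power_divide)
  subgoal by (rule order.trans[OF _ exp_ge_Taylor_even[of 20]]) 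
    (simp_all add: lessThan_nat_numeral fact_numeral power_divide)
  done

text \<open>The tangent of exp at 1 passes through the origin; 2.7 replaces its slope e.\<close>

lemma le_exp_unit: "2.7 * s \<le> exp s" if "0 \<le> s" for s :: real
proof -
  have "2.7 * s \<le> exp 1 * s"
    using exp_numeric_bounds(1) that by (intro mult_right_mono)
  then show ?thesis using exp_ge_tangent[of 1 s] by simp
qed

section \<open>Nonnegativity of the quadratic in \<open>lam\<close>\<close>

lemma exp_sum_le_two:
  fixes y :: real
  assumes "0 \<le> y" "y \<le> 3.3"
  shows "exp (0.1635 * y) + y / 2 * exp (- 0.6635 * y) \<le> 2"
proof -
  have "exp (0.1635 * y) \<le> exp 0.53955"
    using assms by simp
  also have "\<dots> \<le> 1.72"
    using exp_numeric_bounds(2) by (simp add: exp_minus field_simps)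
  finally have 1: "exp (0.1635 * y) \<le> 1.72" .
  \<comment> \<open>2.7 * 0.6635 exceeds 1.79, and 1 / (2 * 1.79) is below 0.28, which is what 1.72
    leaves of 2.\<close>
  have "y * 1.79 \<le> exp (0.6635 * y)"
    using le_exp_unit[of "0.6635 * y"] assms by simp
  then have "y / 2 * exp (- 0.6635 * y) \<le> 0.28"
    using assms by (simp add: exp_minus field_simps)
  with 1 show ?thesis by simp
qed

text \<open>Both \<open>a\<close> and \<open>b\<close> contain the factor sqrt (2 b) = y exp (-
  0.6635 y), where 0.6635 = 1.327 / 2. Dividing it out of a + b \<le> 2 sqrt (2 b) leaves
  \<open>exp_sum_le_two\<close>.\<close>

lemma coeff_sum_sq_le:
  fixes y :: real
  assumes "0 \<le> y" "y \<le> 3.3"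
  defines "a \<equiv> y * exp (- y / 2)" and "b \<equiv> y\<^sup>2 / 2 * exp (- 1.327 * y)"
  shows "(a + b)\<^sup>2 \<le> 8 * b"
proof -
  define e where "e = y * exp (- 0.6635 * y)"
  have "a + b = e * (exp (0.1635 * y) + y / 2 * exp (- 0.6635 * y))"
    by (simp add: a_def b_def e_def algebra_simps power2_eq_square flip: exp_add)
  also have "\<dots> \<le> e * 2"
    using exp_sum_le_two assms by (intro mult_left_mono) (auto simp: e_def)
  finally have "(a + b)\<^sup>2 \<le> (e * 2)\<^sup>2"
    using assms(1) by (intro power_mono) (auto simp: a_def b_def)
  also have "\<dots> = 8 * b"
    by (simp add: e_def b_def power2_eq_square algebra_simps flip: exp_add)
  finally show ?thesis .
qed

text \<open>Since 0.732 = 4 * 0.183, this makes the derivative 4 lam - (a + b) of the quadratic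
  nonnegative from \<open>lam\<close> = 0.183 on.\<close>

lemma coeff_sum_le:
  fixes y :: real
  assumes "3.3 \<le> y"
  shows "y * exp (- y / 2) + y\<^sup>2 / 2 * exp (- 1.327 * y) \<le> 0.732"
proof -
  \<comment> \<open>Factoring out \<open>exp (- y / 2)\<close> leaves the rate 0.827 = 1.327 - 1 /
    2. Tangents at y = 3.3 reduce both estimates to linear inequalities that hold at 3.3 and have
    the larger slope on the right.\<close>
  have "15.3 * (1 + 0.827 * (y - 3.3)) \<le> exp 2.7291 * (1 + (0.827 * y - 2.7291))"
    using exp_numeric_bounds(4) assms by (intro mult_mono) (auto simp: field_simps)
  also have "\<dots> \<le> exp (0.827 * y)"
    by (rule exp_ge_tangent)
  finally have "y \<le> 0.216 * exp (0.827 * y)"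
    using assms by (simp add: field_simps)
  then have "y * exp (- 0.827 * y) \<le> 0.216"
    by (simp add: exp_minus field_simps)
  then have "y * (1 + y * exp (- 0.827 * y) / 2) \<le> y * 1.108"
    using assms by (intro mult_left_mono) auto
  also have "\<dots> \<le> 0.732 * (5.2 * (1 + (y / 2 - 1.65)))"
    using assms by simp
  also have "\<dots> \<le> 0.732 * (exp 1.65 * (1 + (y / 2 - 1.65)))"
    using exp_numeric_bounds(3) assms by (intro mult_left_mono mult_right_mono) auto
  also have "\<dots> \<le> 0.732 * exp (y / 2)"
    using exp_ge_tangent[of "1.65" "y / 2"] by simp
  finally have "y * (1 + y * exp (- 0.827 * y) / 2) * exp (- y / 2) \<le> 0.732"
    by (simp add: exp_minus field_simps)
  then show ?thesis
    by (simp add: algebra_simps power2_eq_square flip: exp_add)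
qed

text \<open>The expression in \<open>critical_lam\<close>, multiplied by \<open>exp (y / 2)\<close>,
  at y = 4.12 + t, with cubic Taylor polynomials for the exponentials; 7.845 and 0.0331 stand for
  \<open>exp 2.06\<close> and \<open>exp (- 3.40724)\<close>. Its value at t = 0 is only about
  0.001.\<close>

lemma quintic_nonneg:
  fixes t :: real
  assumes "- 0.85 \<le> t" "t \<le> 1.4"
  shows "0 \<le> 2 * 0.183\<^sup>2 * 7.845 * (1 + t / 2 + (t / 2)\<^sup>2 / 2 + (t / 2) ^ 3 / 6)
    - 0.183 * (4.12 + t)
    + 0.817 / 2 * 0.0331 * (4.12 + t)\<^sup>2 *
        (1 + (- 0.827 * t) + (- 0.827 * t)\<^sup>2 / 2 + (- 0.827 * t) ^ 3 / 6)" (is "0 \<le> ?p")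
proof -
  have "t\<^sup>2 \<le> 1.4\<^sup>2"
    using assms by (intro abs_le_square_iff[THEN iffD1]) auto
  have "t ^ 3 \<le> 1.4 ^ 3"
    using assms by (intro power_mono_odd) auto
  have "0 \<le> (t + 0.03)\<^sup>2" by simp
  \<comment> \<open>The coefficient of \<open>t\<^sup>2\<close> is split: 0.03 of it controls the
    linear term in \<open>?q\<close>, which exceeds 0.03 (t + 0.03)^2 for t \<le> 1.4.\<close>
  then have "0 \<le> 0.03 * t\<^sup>2 + 16584156939 / 12500000000000 * t + 1561271 / 1562500000" (is "0 \<le> ?q")
    using assms by (simp add: power2_eq_square field_simps)
  \<comment> \<open>The cubic factor is estimated term by term, with t \<ge> -0.85 in its linear
    term.\<close>
  moreover have "0 \<le> t\<^sup>2 * (888682025798947 / 25000000000000000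
      + 1217153404700470831 / 75000000000000000000 * t
      - 8818737683993123 / 1500000000000000000 * t\<^sup>2
      - 152956021573841 / 120000000000000000 * t ^ 3)" (is "0 \<le> ?r")
    using \<open>t\<^sup>2 \<le> _\<close> \<open>t ^ 3 \<le> _\<close> assms
    by (intro mult_nonneg_nonneg) (auto simp: power_divide)
  moreover have "?p = ?q + ?r"
    by (simp add: power2_eq_square power3_eq_cube field_simps)
  ultimately show ?thesis by linarith
qed

lemma critical_lam:
  fixes y :: real
  assumes "3.3 \<le> y"
  shows "0 \<le> 2 * 0.183\<^sup>2 - 0.183 * (y * exp (- y / 2))
           + 0.817 * (y\<^sup>2 / 2 * exp (- 1.327 * y))"
proof (cases "y \<le> 5.5")
  case True
  define t where "t = y - 4.12"
  have y: "y = 4.12 + t" by (simp add: t_def)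
  have t: "- 0.85 \<le> t" "t \<le> 1.4" using True assms by (auto simp: t_def)
  let ?P = "1 + t / 2 + (t / 2)\<^sup>2 / 2 + (t / 2) ^ 3 / 6"
  let ?Q = "1 + (- 0.827 * t) + (- 0.827 * t)\<^sup>2 / 2 + (- 0.827 * t) ^ 3 / 6"
  have "7.845 * ?P \<le> 7.845 * exp (t / 2)"
    using exp_ge_Taylor_cubic[of "t / 2"] by simp
  also have "\<dots> \<le> exp 2.06 * exp (t / 2)"
    using exp_numeric_bounds(6) by (intro mult_right_mono) auto
  also have "\<dots> = exp (y / 2)"
    by (simp add: y add_divide_distrib flip: exp_add)
  finally have P: "7.845 * ?P \<le> exp (y / 2)" .
  have "0.0331 * ?Q \<le> 0.0331 * exp (- 0.827 * t)"
    using exp_ge_Taylor_cubic[of "- 0.827 * t"] by (intro mult_left_mono) auto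
  also have "\<dots> \<le> exp (- 3.40724) * exp (- 0.827 * t)"
    using exp_numeric_bounds(7) by (intro mult_right_mono) auto
  also have "\<dots> = exp (- 0.827 * y)"
    by (simp add: y algebra_simps flip: exp_add)
  finally have Q: "0.0331 * ?Q \<le> exp (- 0.827 * y)" .
  \<comment> \<open>Multiplication by \<open>exp (y / 2)\<close> frees the negative term of its
    exponential. The other two have nonnegative coefficients, so lower bounds suffice.\<close>
  have "0 \<le> 2 * 0.183\<^sup>2 * (7.845 * ?P) - 0.183 * y + 0.817 / 2 * y\<^sup>2 * (0.0331 * ?Q)"
    using quintic_nonneg[OF t] unfolding y by (simp only: mult_ac)
  also have "\<dots> \<le> 2 * 0.183\<^sup>2 * exp (y / 2) - 0.183 * y + 0.817 / 2 * y\<^sup>2 * exp (- 0.827 * y)"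
    using P Q by (intro add_mono diff_mono mult_left_mono order_refl) auto
  finally have "0 \<le> \<dots> * exp (- y / 2)" by simp
  also have "\<dots> = 2 * 0.183\<^sup>2 * (exp (y / 2) * exp (- y / 2)) - 0.183 * (y * exp (- y / 2))
      + 0.817 * (y\<^sup>2 / 2 * (exp (- 0.827 * y) * exp (- y / 2)))"
    by (simp only: left_diff_distrib distrib_right times_divide_eq_left times_divide_eq_right
        mult.assoc)
  also have "exp (y / 2) * exp (- y / 2) = 1"
    by (simp flip: exp_add)
  also have "exp (- 0.827 * y) * exp (- y / 2) = exp (- 1.327 * y)"
    by (simp flip: exp_add)
  finally show ?thesis by simp
next
  case False
  have "y \<le> 0.366 * (15.6 * (1 + (y / 2 - 2.75)))"
    using False by simp
  also have "\<dots> \<le> 0.366 * (exp 2.75 * (1 + (y / 2 - 2.75)))"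
    using exp_numeric_bounds(5) False by (intro mult_left_mono mult_right_mono) auto
  also have "\<dots> \<le> 0.366 * exp (y / 2)"
    using exp_ge_tangent[of "2.75" "y / 2"] by simp
  finally have "y * exp (- y / 2) \<le> 0.366"
    by (simp add: exp_minus field_simps)
  moreover have "0 \<le> y\<^sup>2 / 2 * exp (- 1.327 * y)" by simp
  ultimately show ?thesis by (simp add: power2_eq_square)
qed

lemma lower_bound_poly:
  fixes lam y :: real
  assumes "0.183 \<le> lam" "0 \<le> y"
  defines "a \<equiv> y * exp (- y / 2)" and "b \<equiv> y\<^sup>2 / 2 * exp (- 1.327 * y)"
  shows "0 \<le> 2 * lam\<^sup>2 - lam * a + (1 - lam) * b"
proof (cases "y \<le> 3.3")
  case True
  then have "(a + b)\<^sup>2 \<le> 8 * b"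
    using coeff_sum_sq_le assms(2) by (simp add: a_def b_def)
  moreover have "8 * (2 * lam\<^sup>2 - lam * a + (1 - lam) * b)
      = (4 * lam - (a + b))\<^sup>2 + (8 * b - (a + b)\<^sup>2)"
    by (simp add: power2_eq_square algebra_simps)
  moreover have "0 \<le> (4 * lam - (a + b))\<^sup>2" by simp
  ultimately have "0 \<le> 8 * (2 * lam\<^sup>2 - lam * a + (1 - lam) * b)" by simp
  then show ?thesis by (simp only: zero_le_mult_iff) simp
next
  case False
  then have "a + b \<le> 0.732" "0 \<le> 2 * 0.183\<^sup>2 - 0.183 * a + 0.817 * b"
    using coeff_sum_le[of y] critical_lam[of y] by (simp_all add: a_def b_def)
  moreover have "2 * lam\<^sup>2 - lam * a + (1 - lam) * b
      = (2 * 0.183\<^sup>2 - 0.183 * a + 0.817 * b) + (lam - 0.183) * (2 * (lam + 0.183) - (a + b))"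
    by (simp add: power2_eq_square field_simps)
  moreover have "0 \<le> (lam - 0.183) * (2 * (lam + 0.183) - (a + b))"
    using assms(1) calculation(1) by (intro mult_nonneg_nonneg) auto
  ultimately show ?thesis by linarith
qed

section \<open>Bounds for the stability function\<close>

lemma stability_function_alt:
  assumes "\<alpha> \<noteq> 0"
  shows "stability_function \<alpha> (- x) lam
    = 1 - x * exp (- (lam * x) / 2) + (1 - lam) / 2 * x\<^sup>2 * exp (- ((1 + \<alpha>) * lam * x))"
proof -
  have "exp (- ((1 + \<alpha>) * lam * x)) = exp (- (lam * x)) * exp (- (\<alpha> * lam * x))"
    by (simp add: algebra_simps flip: exp_add)
  \<comment> \<open>The factor \<open>\<alpha>\<close> in U - 1 cancels against 1 / (2
    \<alpha>).\<close>
  then show ?thesis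
    using assms by (simp add: stability_function_def power2_eq_square)
qed

lemma unconditionally_stable_0327:
  assumes "0.183 \<le> lam" "lam \<le> 1"
  shows "unconditionally_stable lam 0.327"
  unfolding unconditionally_stable_def
proof
  fix z :: real
  assume "z \<in> {..0}"
  define x where "x = - z"
  have x: "0 \<le> x" "z = - x" using \<open>z \<in> {..0}\<close> by (auto simp: x_def)
  define \<Phi> where "\<Phi> = stability_function 0.327 z lam"
  have \<Phi>: "\<Phi> = 1 - x * exp (- (lam * x) / 2) + (1 - lam) / 2 * x\<^sup>2 * exp (- 1.327 * (lam * x))"
    unfolding \<Phi>_def x(2) by (subst stability_function_alt) (simp_all add: mult.assoc)
  \<comment> \<open>This is tight: at \<open>lam\<close> = 0.183 it compares 0.817 with 2 * 2.7 *
    0.827 * 0.183, about 0.81724.\<close>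
  have "(1 - lam) * x \<le> 2 * (2.7 * (0.827 * lam)) * x"
    using assms x by (intro mult_right_mono) auto
  also have "\<dots> = 2 * (2.7 * (0.827 * (lam * x)))" by simp
  also have "\<dots> \<le> 2 * exp (0.827 * (lam * x))"
    using le_exp_unit[of "0.827 * (lam * x)"] assms x by simp
  finally have "(1 - lam) / 2 * x * exp (- 0.827 * (lam * x)) \<le> 1"
    by (simp add: exp_minus field_simps)
  then have "x * exp (- (lam * x) / 2) * ((1 - lam) / 2 * x * exp (- 0.827 * (lam * x)))
      \<le> x * exp (- (lam * x) / 2) * 1"
    using x by (intro mult_left_mono) auto
  moreover have "exp (- 1.327 * (lam * x)) = exp (- (lam * x) / 2) * exp (- 0.827 * (lam * x))"
    by (simp flip: exp_add)
  ultimately have upper: "\<Phi> \<le> 1"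
    unfolding \<Phi> by (simp add: power2_eq_square mult_ac)
  \<comment> \<open>Scaling \<Phi> + 1 by \<open>lam\<^sup>2\<close> makes it the quadratic with y =
    lam x.\<close>
  have "0 \<le> 2 * lam\<^sup>2 - lam * (lam * x * exp (- (lam * x) / 2))
      + (1 - lam) * ((lam * x)\<^sup>2 / 2 * exp (- 1.327 * (lam * x)))"
    using lower_bound_poly[of lam "lam * x"] assms x by simp
  also have "\<dots> = lam\<^sup>2 * (\<Phi> + 1)"
    unfolding \<Phi> by (simp add: power2_eq_square algebra_simps)
  finally have "0 \<le> \<Phi> + 1"
    using assms by (simp add: zero_le_mult_iff)
  with upper show "\<bar>stability_function 0.327 z lam\<bar> \<le> 1"
    unfolding \<Phi>_def by simp
qed

section \<open>Action of one step on Fourier coefficients\<close>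

lemma set_integrable_mult_fourier_mode:
  fixes u :: "real ^ 'd \<Rightarrow> complex" and k :: "int ^ 'd"
  assumes "set_integrable lborel S u"
  shows "set_integrable lborel S
    (\<lambda>x. u x * exp (- \<i> * of_real (\<Sum>i\<in>UNIV. of_int (k $ i) * x $ i)))"
proof -
  have "continuous_on UNIV
      (\<lambda>x::real ^ 'd. exp (- \<i> * of_real (\<Sum>i\<in>UNIV. of_int (k $ i) * x $ i)))"
    by (intro continuous_intros)
  then have m: "(\<lambda>x::real ^ 'd. exp (- \<i> * of_real (\<Sum>i\<in>UNIV. of_int (k $ i) * x $ i)))
      \<in> borel_measurable borel"
    by (rule borel_measurable_continuous_onI)
  let ?f = "\<lambda>x. indicator S x *\<^sub>R u x"
  have f: "integrable lborel ?f" using assms by (simp add: set_integrable_def)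
  \<comment> \<open>A Fourier mode is continuous with modulus 1, so \<open>?f\<close> itself
    dominates the product.\<close>
  have "integrable lborel
      (\<lambda>x. ?f x * exp (- \<i> * of_real (\<Sum>i\<in>UNIV. of_int (k $ i) * x $ i)))"
  proof (rule Bochner_Integration.integrable_bound[OF f])
    show "(\<lambda>x. ?f x * exp (- \<i> * of_real (\<Sum>i\<in>UNIV. of_int (k $ i) * x $ i)))
        \<in> borel_measurable lborel"
      using f m by (intro borel_measurable_times) auto
  qed (simp add: norm_mult)
  then show ?thesis by (simp add: set_integrable_def)
qed

lemma fourier_coeff_add:
  assumes "set_integrable lborel Omega u" "set_integrable lborel Omega v"
  shows "fourier_coeff (\<lambda>x. u x + v x) k = fourier_coeff u k + fourier_coeff v k"
  using set_integral_add(2)[OF assms[THEN set_integrable_mult_fourier_mode[where k = k]]]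
  by (simp add: fourier_coeff_def add_divide_distrib ring_distribs)

text \<open>The integral of a nonintegrable function is 0 by default, so a constant always comes
  out.\<close>

lemma fourier_coeff_cmult: "fourier_coeff (\<lambda>x. c * u x) k = c * fourier_coeff u k"
  by (simp add: fourier_coeff_def mult.assoc)

lemma fourier_coeff_lawson2_step:
  assumes "lawson2_step \<tau> lam \<alpha> u U u'" "\<alpha> \<noteq> 0"
  shows "fourier_coeff u' k = of_real (stability_function \<alpha> (- \<tau> * ksq k) lam) * fourier_coeff u k"
proof -
  from assms(1) obtain V W Y where
    V: "laplace_fun (\<lambda>s. exp (\<alpha> * \<tau> * lam * s) * s) u V" and
    U: "U = (\<lambda>x. u x + of_real (\<alpha> * \<tau>) * V x)" and
    W: "laplace_fun (\<lambda>s. exp (\<tau> / 2 * lam * s) * s) u W" and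
    Y: "laplace_fun (\<lambda>s. exp (\<tau> * lam * s) * (1 - lam) * s) (\<lambda>x. U x - u x) Y" and
    u': "u' = (\<lambda>x. u x + of_real \<tau> * W x + of_real (\<tau> / (2 * \<alpha>)) * Y x)"
    unfolding lawson2_step_def by blast
  have int: "set_integrable lborel Omega u" "set_integrable lborel Omega W"
    "set_integrable lborel Omega Y"
    using W Y by (auto simp: laplace_fun_def periodic_fun_def)
  have "fourier_coeff u' k = fourier_coeff u k + of_real \<tau> * fourier_coeff W k
      + of_real (\<tau> / (2 * \<alpha>)) * fourier_coeff Y k"
    unfolding u' using int
    by (simp only: fourier_coeff_add fourier_coeff_cmult set_integral_add set_integrable_mult_right)
  \<comment> \<open>This eliminates the internal stage: U - u is pointwise a multiple of
    \<open>V\<close>.\<close>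
  moreover have "fourier_coeff (\<lambda>x. U x - u x) k = of_real (\<alpha> * \<tau>) * fourier_coeff V k"
    unfolding U by (simp only: add_diff_cancel_left' fourier_coeff_cmult)
  moreover have "fourier_coeff V k = of_real (exp (\<alpha> * \<tau> * lam * - ksq k) * - ksq k) * fourier_coeff u k"
    "fourier_coeff W k = of_real (exp (\<tau> / 2 * lam * - ksq k) * - ksq k) * fourier_coeff u k"
    "fourier_coeff Y k = of_real (exp (\<tau> * lam * - ksq k) * (1 - lam) * - ksq k)
      * fourier_coeff (\<lambda>x. U x - u x) k"
    using V W Y by (simp_all only: laplace_fun_def)
  ultimately have "fourier_coeff u' k = of_real (1 + \<tau> * (exp (\<tau> / 2 * lam * - ksq k) * - ksq k)
      + \<tau> / (2 * \<alpha>) * (exp (\<tau> * lam * - ksq k) * (1 - lam) * - ksq k)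
        * (\<alpha> * \<tau> * (exp (\<alpha> * \<tau> * lam * - ksq k) * - ksq k))) * fourier_coeff u k"
    by (simp only: of_real_add of_real_mult of_real_1 distrib_right mult.assoc mult_1)
  \<comment> \<open>Every symbol \<open>- ksq k\<close> is paired with one \<tau>, so the factor
    depends on them only through z = - \<tau> \<open>ksq k\<close>.\<close>
  also have "1 + \<tau> * (exp (\<tau> / 2 * lam * - ksq k) * - ksq k)
      + \<tau> / (2 * \<alpha>) * (exp (\<tau> * lam * - ksq k) * (1 - lam) * - ksq k)
        * (\<alpha> * \<tau> * (exp (\<alpha> * \<tau> * lam * - ksq k) * - ksq k))
      = stability_function \<alpha> (- \<tau> * ksq k) lam"
    by (simp add: stability_function_def mult_ac)
  finally show ?thesis .
qed

theorem theorem2p7: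
  fixes lam \<alpha> \<tau> :: real
  assumes "lam \<in> {0..1}" and "\<alpha> = 0.327" and "\<tau> > 0" and "lam \<ge> 0.183"
  shows "(\<forall>(u :: real ^ 'd \<Rightarrow> complex) U u' k. lawson2_step \<tau> lam \<alpha> u U u' \<longrightarrow>
            fourier_coeff u' k =
              of_real (stability_function \<alpha> (- \<tau> * ksq k) lam) * fourier_coeff u k)
         \<and> unconditionally_stable lam \<alpha>"
proof (intro conjI allI impI)
  fix u U u' :: "real ^ 'd \<Rightarrow> complex" and k
  assume "lawson2_step \<tau> lam \<alpha> u U u'"
  then show "fourier_coeff u' k
      = of_real (stability_function \<alpha> (- \<tau> * ksq k) lam) * fourier_coeff u k"
    by (rule fourier_coeff_lawson2_step) (simp add: assms(2))
next
  show "unconditionally_stable lam \<alpha>"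
    unfolding assms(2) using assms by (intro unconditionally_stable_0327) auto
qed

end
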